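(* Let $\mathbb{R}^n$ be endowed with the Euclidean norm, let $p\ge 2$, let $g_i:\mathbb{R}^n\to\mathbb{R}$, $i=1,\dots,m$, be convex functions, let $\overline b\in\mathbb{R}^m\setminus\Theta_c$, and assume that $S_i:=\{x\in\mathbb{R}^n: g_i(x)\le\overline b_i\}\neq\emptyset$ for $i=1,\dots,m$. Let $\emptyset\neq C\subset\mathbb{R}^n$ be a closed convex set and let $u=(u_i)_{i=1,\dots,m}$, $l=(l_i)_{i=1,\dots,m}$ be such that, for each $i$, $$u_i\ge d_*(0_n,\partial g_i(x))\ \text{ for all } x\in C,\qquad 0<l_i\le d_*(0_n,\partial g_i(P_{S_i}(x)))\ \text{ for all } x\in\mathbb{R}^n\setminus S_i .$$ Set $$\mathcal{A}(C,u):=\arg\min_{x\in\mathbb{R}^n}\sum_{i=1}^m u_i^p\, d_{S_i}^p(x)+I_C(x),\qquad \mathcal{A}(l):=\arg\min_{x\in\mathbb{R}^n}\sum_{i=1}^m l_i^p\, d_{S_i}^p(x),$$ and assume that $\mathcal{A}(C,u)$ and $\mathcal{A}(l)$ are nonempty. Then: (i) For each $i=1,\dots,m$, $d_{S_i}$ is constant on $\mathcal{A}(C,u)$ and is constant on $\mathcal{A}(l)$. (ii) For each $i=1,\dots,m$, let $d_i^+$ and $d_i^-$ denote the constant values of $u_i d_{S_i}(\cdot)$ on $\mathcal{A}(C,u)$ and of $l_i d_{S_i}(\cdot)$ on $\mathcal{A}(l)$, respectively, and let $d^+=(d_i^+)_{i=1,\dots,m}$, $d^-=(d_i^-)_{i=1,\dots,m}$.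 Then $$d_p(\overline b,\Theta_c)\le\|d^+\|_p .$$ If, in addition, for each $i=1,\dots,m$ there exists $\widehat x_i\in\mathbb{R}^n$ such that $g_i(\widehat x_i)<\overline b_i$, then $$d_p(\overline b,\Theta_c)\ge\|d^-\|_p .$$
   Context: $\Theta_c$ is the set of $b\in\mathbb{R}^m$ such that the system $\{g_i(x)\le b_i,\ i=1,\dots,m\}$ has a solution $x\in\mathbb{R}^n$. $p$ is a (finite) real number, $\|\cdot\|_p$ is the $p$-norm on $\mathbb{R}^m$ and $d_p(\overline b,\Theta_c)=\inf\{\|\overline b-b\|_p:b\in\Theta_c\}$. $\partial g_i(x)$ is the convex subdifferential of $g_i$ at $x$; $d_*(0_n,D)=\inf\{\|v\|_*:v\in D\}$ is the distance from the origin to $D\subset\mathbb{R}^n$ in the dual norm (here the Euclidean norm). $P_{S_i}(x)$ is the Euclidean projection of $x$ on $S_i$ and $d_{S_i}(x)$ is the Euclidean distance from $x$ to $S_i$. $I_C$ is the indicator function of $C$: $I_C(x)=0$ if $x\in C$, $I_C(x)=+\infty$ otherwise. *)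

theory Defs
  imports "HOL-Analysis.Analysis"
begin

definition consistent_rhs :: "('m::finite \<Rightarrow> real^'n \<Rightarrow> real) \<Rightarrow> (real^'m) set"
  where "consistent_rhs g = {b. \<exists>x. \<forall>i. g i x \<le> b $ i}"

definition pnorm :: "real \<Rightarrow> real^'m::finite \<Rightarrow> real"
  where "pnorm p b = (\<Sum>i\<in>UNIV. \<bar>b $ i\<bar> powr p) powr (1 / p)"

text \<open>The infimum is over a real-valued family, so it is meaningful only for nonempty \<open>T\<close>;
  \<open>consistent_rhs g\<close> is always nonempty.\<close>

definition pdist :: "real \<Rightarrow> real^'m::finite \<Rightarrow> (real^'m) set \<Rightarrow> real"
  where "pdist p b T = (INF b'\<in>T. pnorm p (b - b'))"

definition subdifferential :: "(real^'n \<Rightarrow> real) \<Rightarrow> real^'n \<Rightarrow> (real^'n) set"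
  where "subdifferential f x = {v. \<forall>y. f x + v \<bullet> (y - x) \<le> f y}"

definition sublevel :: "(real^'n \<Rightarrow> real) \<Rightarrow> real \<Rightarrow> (real^'n) set"
  where "sublevel f c = {x. f x \<le> c}"

definition ind_fun :: "'a set \<Rightarrow> 'a \<Rightarrow> ereal"
  where "ind_fun C x = (if x \<in> C then 0 else \<infinity>)"

definition argmin_set :: "('a \<Rightarrow> 'b::linorder) \<Rightarrow> 'a set"
  where "argmin_set f = {x. is_arg_min f (\<lambda>_. True) x}"

text \<open>For \<open>p > 0\<close>, \<open>powr\<close> is the usual power as long as the weights are nonnegative.\<close>

definition wdist_sum ::
    "real \<Rightarrow> real^'m::finite \<Rightarrow> ('m \<Rightarrow> (real^'n) set) \<Rightarrow> real^'n \<Rightarrow> real"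
  where "wdist_sum p w S x = (\<Sum>i\<in>UNIV. (w $ i) powr p * (infdist x (S i)) powr p)"

end

theory Submission
  imports Defs
begin

text \<open>
  The power sum of the weighted distances \<open>w $ i * infdist x (S i)\<close> is compared with the cost
  of repairing the right-hand side, coordinate by coordinate.

  A point \<open>x\<close> becomes feasible as soon as each violated \<open>bbar $ i\<close> is raised to \<open>g i x\<close>, so
  the cost at \<open>x\<close> is the \<open>p\<close>-norm of the positive parts of the residuals \<open>g i x - bbar $ i\<close>.
  Convexity encloses each positive part, for \<open>x\<close> in \<open>C\<close> in the case of the upper estimate,
  between two multiples of the distance to \<open>S i\<close>. Along the
  segment from the projection \<open>y\<close> of \<open>x\<close> to \<open>x\<close> the function grows at most at the rate given
  by any subgradient at \<open>x\<close> (\<open>residual_le_infdist\<close>), and at least at the rate given by a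
  subgradient at \<open>y\<close> that points in the direction \<open>x - y\<close> (\<open>residual_ge_infdist\<close>). Evaluating
  the upper estimate at a minimiser over \<open>C\<close> bounds the distance to consistency from above;
  applying the lower estimate to every \<open>x\<close>, and then minimality, bounds it from below.

  The distances are constant on the set of minimisers because \<open>t \<mapsto> t powr p\<close> is strictly
  convex on the nonnegative reals: at the midpoint of two minimisers with different distances
  to some \<open>S i\<close> of positive weight, the sum would be smaller
  (\<open>infdist_eq_of_minimizers\<close>). A weight \<open>u $ i\<close> may vanish, but then every point of \<open>C\<close>
  minimises \<open>g i\<close>, so \<open>C\<close> lies in \<open>S i\<close> and the distance is constantly zero.
\<close>

section \<open>Subgradients and residuals\<close>

text \<open>
  The point \<open>(x, f x)\<close> is separated from the strict epigraph. The separating hyperplane cannot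
  be vertical, because the strict epigraph projects onto the whole space, so it is the graph
  of an affine minorant. The result matters because \<open>infdist 0\<close> of an empty set is \<open>0\<close>, which
  would make an upper bound on it meaningless.
\<close>
lemma subdifferential_nonempty:
  fixes f :: "real^'n \<Rightarrow> real"
  assumes "convex_on UNIV f"
  shows "subdifferential f x \<noteq> {}"
proof -
  let ?E = "{(z, t). f z < t}"
  have conv: "convex ?E"
  proof (rule convexI)
    fix P Q :: "(real^'n) \<times> real" and u v :: real
    assume P: "P \<in> ?E" and Q: "Q \<in> ?E" and uv: "0 \<le> u" "0 \<le> v" "u + v = 1"
    obtain a s b t where ab: "P = (a, s)" "Q = (b, t)" by (metis surj_pair)
    have "f (u *\<^sub>R a + v *\<^sub>R b) \<le> u * f a + v * f b"
      using assms uv by (simp add: convex_on_def)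
    also have "\<dots> < u * s + v * t"
    proof (cases "u = 0")
      case True
      then show ?thesis using uv Q ab by simp
    next
      case False
      then have "u * f a < u * s" using uv P ab by simp
      moreover have "v * f b \<le> v * t" using uv Q ab by (simp add: mult_left_mono)
      ultimately show ?thesis by simp
    qed
    finally show "u *\<^sub>R P + v *\<^sub>R Q \<in> ?E" using ab by simp
  qed
  have "(x, f x + 1) \<in> ?E" by simp
  then have "?E \<noteq> {}" by blast
  moreover have "{(x, f x)} \<inter> ?E = {}" by auto
  ultimately obtain c b where c0: "c \<noteq> 0" and le: "\<forall>q\<in>{(x, f x)}. c \<bullet> q \<le> b"
      and ge: "\<forall>q\<in>?E. b \<le> c \<bullet> q"
    using separating_hyperplane_sets[of "{(x, f x)}" ?E] conv by auto
  obtain \<alpha> \<beta> where c: "c = (\<alpha>, \<beta>)" by (cases c)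
  have sep: "\<alpha> \<bullet> x + \<beta> * f x \<le> \<alpha> \<bullet> z + \<beta> * t" if "f z < t" for z t
    using le ge that unfolding c by fastforce
  have "\<beta> \<ge> 0" using sep[of x "f x + 1"] by (simp add: algebra_simps)
  moreover have "\<beta> \<noteq> 0"
  proof
    assume "\<beta> = 0"
    then have "\<alpha> \<bullet> x \<le> \<alpha> \<bullet> (x - \<alpha>)" using sep[of "x - \<alpha>" "f (x - \<alpha>) + 1"] by simp
    then have "\<alpha> = 0"
      using inner_ge_zero[of \<alpha>] by (simp add: inner_diff_right)
    then show False using c0 c \<open>\<beta> = 0\<close> by (simp add: zero_prod_def)
  qed
  ultimately have b: "\<beta> > 0" by simp
  have "- (1 / \<beta>) *\<^sub>R \<alpha> \<in> subdifferential f x"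
    unfolding subdifferential_def
  proof (intro CollectI allI)
    fix z
    show "f x + (- (1 / \<beta>) *\<^sub>R \<alpha>) \<bullet> (z - x) \<le> f z"
    proof (rule dense_ge)
      fix t assume "f z < t"
      from sep[OF this] show "f x + (- (1 / \<beta>) *\<^sub>R \<alpha>) \<bullet> (z - x) \<le> t"
        using b by (simp add: field_simps inner_diff_right)
    qed
  qed
  then show ?thesis by blast
qed

lemma closed_subdifferential: "closed (subdifferential f x)"
proof -
  have "subdifferential f x = (\<Inter>y. {v. f x + v \<bullet> (y - x) \<le> f y})"
    by (auto simp: subdifferential_def)
  moreover have "closed {v. f x + v \<bullet> (y - x) \<le> f y}" for y
    by (intro closed_Collect_le continuous_intros)
  ultimately show ?thesis by auto
qed

lemma sublevel_convex_closed:
  fixes f :: "real^'n \<Rightarrow> real"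
  assumes "convex_on UNIV f"
  shows "convex (sublevel f c)" and "closed (sublevel f c)"
proof -
  show "convex (sublevel f c)"
    using convex_lower[OF assms]
    by (fastforce simp: sublevel_def intro!: convexI elim: order_trans)
  have "continuous_on UNIV f"
    using assms by (rule convex_on_continuous[OF open_UNIV])
  then show "closed (sublevel f c)"
    unfolding sublevel_def by (intro closed_Collect_le continuous_intros) auto
qed

lemma infdist_eq_dist_closest_point:
  fixes S :: "'a::{real_inner, heine_borel} set"
  assumes "closed S" "S \<noteq> {}"
  shows "infdist x S = dist x (closest_point S x)"
proof (rule antisym)
  show "infdist x S \<le> dist x (closest_point S x)"
    by (simp add: assms closest_point_in_set infdist_le)
  show "dist x (closest_point S x) \<le> infdist x S"
    using assms by (simp add: infdist_notempty closest_point_le cINF_greatest)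
qed

text \<open>
  A subgradient \<open>v\<close> at \<open>x\<close> bounds \<open>f x - f y\<close> by \<open>norm v * dist x y\<close> for the projection \<open>y\<close>
  of \<open>x\<close>; the infimum over \<open>v\<close> is attained because the subdifferential is closed.
\<close>
lemma residual_le_infdist:
  fixes f :: "real^'n \<Rightarrow> real"
  assumes "convex_on UNIV f" "sublevel f c \<noteq> {}"
  shows "f x - c \<le> infdist 0 (subdifferential f x) * infdist x (sublevel f c)"
proof -
  let ?S = "sublevel f c" and ?y = "closest_point (sublevel f c) x"
  have cl: "closed ?S" using assms by (simp add: sublevel_convex_closed)
  have "f ?y \<le> c"
    using closest_point_in_set[OF cl assms(2), of x] by (simp add: sublevel_def)
  obtain v where v: "v \<in> subdifferential f x"
      and inf: "infdist 0 (subdifferential f x) = norm v"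
    using infdist_attains_inf[OF closed_subdifferential subdifferential_nonempty[OF assms(1)]]
    by (metis dist_0_norm)
  have "f x + v \<bullet> (?y - x) \<le> f ?y" using v by (simp add: subdifferential_def)
  then have "f x - c \<le> v \<bullet> (x - ?y)"
    using \<open>f ?y \<le> c\<close> by (simp add: inner_diff_right)
  also have "\<dots> \<le> norm v * norm (x - ?y)" by (rule norm_cauchy_schwarz)
  finally show ?thesis
    by (simp add: inf infdist_eq_dist_closest_point[OF cl assms(2)] dist_norm)
qed

text \<open>
  The half-space on the far side of the projection \<open>y\<close>, bounded by the hyperplane through \<open>y\<close>
  orthogonal to \<open>d = x - y\<close>, meets the sublevel set at most in its bounding hyperplane, where
  continuity still gives \<open>f \<ge> c\<close>. A multiple \<open>\<mu>\<close> of \<open>d\<close> that is a subgradient at \<open>y\<close> is found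
  by a one-dimensional argument: slopes measured from level \<open>c\<close> on the far side dominate those
  on the near side, because the segment joining two points on opposite sides crosses the
  hyperplane at a value of at least \<open>c\<close>. The infimum \<open>\<mu>\<close> of the far slopes, which is
  nonnegative since \<open>f > c\<close> there, therefore separates the two families.
\<close>
lemma subgradient_normal_at_closest_point:
  fixes f :: "real^'n \<Rightarrow> real"
  assumes cv: "convex_on UNIV f" and ne: "sublevel f c \<noteq> {}" and x: "x \<notin> sublevel f c"
  defines "y \<equiv> closest_point (sublevel f c) x"
  shows "\<exists>\<mu>\<ge>0. \<mu> *\<^sub>R (x - y) \<in> subdifferential f y" and "f y = c"
proof -
  define d where "d = x - y"
  have S: "convex (sublevel f c)" "closed (sublevel f c)"
    using cv by (simp_all add: sublevel_convex_closed)
  have yS: "y \<in> sublevel f c"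
    unfolding y_def using closest_point_in_set[OF S(2) ne] .
  then have "d \<noteq> 0" using x d_def by auto
  then have d0: "d \<bullet> d > 0" by simp
  have far: "f z > c" if "d \<bullet> (z - y) > 0" for z
    using closest_point_dot[OF S, of z x] that
    by (force simp: sublevel_def d_def y_def not_less)
  have cont: "continuous_on UNIV f" using cv by (rule convex_on_continuous[OF open_UNIV])
  have on: "f z \<ge> c" if "d \<bullet> (z - y) = 0" for z
  proof (rule tendsto_lowerbound)
    have "isCont f z" using cont by (simp add: continuous_on_eq_continuous_at)
    moreover have "((\<lambda>t. z + t *\<^sub>R d) \<longlongrightarrow> z + 0 *\<^sub>R d) (at_right 0)"
      by (intro tendsto_intros)
    ultimately show "((\<lambda>t. f (z + t *\<^sub>R d)) \<longlongrightarrow> f z) (at_right 0)"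
      using isCont_tendsto_compose[of z f] by simp
    have "f (z + t *\<^sub>R d) \<ge> c" if "t > 0" for t
      using far[of "z + t *\<^sub>R d"] that \<open>d \<bullet> (z - y) = 0\<close> d0
      by (simp add: inner_diff_right inner_add_right)
    then show "\<forall>\<^sub>F t in at_right 0. c \<le> f (z + t *\<^sub>R d)"
      by (rule eventually_mono[OF eventually_at_right_less])
  qed simp
  show fy: "f y = c"
    using on[of y] yS by (simp add: sublevel_def)
  let ?slope = "\<lambda>z. (f z - c) / (d \<bullet> (z - y))"
  let ?F = "{z. d \<bullet> (z - y) > 0}"
  define \<mu> where "\<mu> = (INF z\<in>?F. ?slope z)"
  have F: "?F \<noteq> {}" using d0 d_def by blast
  have pos: "0 \<le> ?slope z" if "z \<in> ?F" for z
    using that far[of z] by simp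
  have "\<mu> \<ge> 0" unfolding \<mu>_def using F pos by (intro cINF_greatest) auto
  have low: "\<mu> \<le> ?slope z" if "z \<in> ?F" for z
    unfolding \<mu>_def using that pos by (intro cINF_lower bdd_belowI2[where m = 0]) auto
  have near: "?slope w \<le> \<mu>" if w: "d \<bullet> (w - y) < 0" for w
    unfolding \<mu>_def
  proof (rule cINF_greatest[OF F])
    fix z assume "z \<in> ?F"
    \<comment> \<open>The weights are chosen so that the point \<open>?q\<close> of the segment from \<open>w\<close> to \<open>z\<close> lies on the hyperplane.\<close>
    define s r where "s = d \<bullet> (z - y)" and "r = - (d \<bullet> (w - y))"
    have sr: "s > 0" "r > 0" using \<open>z \<in> ?F\<close> w by (simp_all add: s_def r_def)
    let ?q = "(r / (r + s)) *\<^sub>R z + (s / (r + s)) *\<^sub>R w"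
    have weight: "1 - s / (r + s) = r / (r + s)" using sr by (simp add: field_simps)
    have sum1: "r / (r + s) + s / (r + s) = 1" using sr by (simp flip: add_divide_distrib)
    have "?q - y = (r / (r + s)) *\<^sub>R (z - y) + (s / (r + s)) *\<^sub>R (w - y)
        + (r / (r + s) + s / (r + s) - 1) *\<^sub>R y"
      by (simp add: algebra_simps)
    then have "?q - y = (r / (r + s)) *\<^sub>R (z - y) + (s / (r + s)) *\<^sub>R (w - y)"
      by (simp add: sum1)
    then have "d \<bullet> (?q - y) = (r / (r + s)) * (d \<bullet> (z - y)) + (s / (r + s)) * (d \<bullet> (w - y))"
      by (simp only: inner_add_right inner_scaleR_right)
    moreover have "d \<bullet> (w - y) = - r" by (simp add: r_def)
    ultimately have "d \<bullet> (?q - y) = (r / (r + s)) * s + (s / (r + s)) * (- r)"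
      by (simp only: s_def)
    then have "c \<le> f ?q" by (intro on) simp
    also have "\<dots> \<le> (r / (r + s)) * f z + (s / (r + s)) * f w"
      using convex_onD[OF cv, of "s / (r + s)" z w] sr unfolding weight by simp
    also have "\<dots> = (r * f z + s * f w) / (r + s)" by (simp add: add_divide_distrib)
    finally have "c * (r + s) \<le> r * f z + s * f w"
      using sr by (simp add: pos_le_divide_eq)
    then have "(c - f w) * s \<le> (f z - c) * r" by (simp add: algebra_simps)
    then have "(c - f w) / r \<le> (f z - c) / s"
      using sr by (simp add: pos_divide_le_eq pos_le_divide_eq)
    moreover have "(c - f w) / r = ?slope w"
      unfolding r_def by (metis minus_diff_eq minus_divide_divide minus_minus)
    ultimately show "?slope w \<le> ?slope z" by (simp only: s_def)
  qed
  have "\<mu> *\<^sub>R d \<in> subdifferential f y"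
    unfolding subdifferential_def
  proof (intro CollectI allI)
    fix z
    consider "d \<bullet> (z - y) > 0" | "d \<bullet> (z - y) = 0" | "d \<bullet> (z - y) < 0" by linarith
    then show "f y + (\<mu> *\<^sub>R d) \<bullet> (z - y) \<le> f z"
    proof cases
      case 1
      then show ?thesis using low[of z] by (simp add: fy pos_le_divide_eq)
    next
      case 2
      then show ?thesis using on[of z] by (simp add: fy)
    next
      case 3
      then show ?thesis using near[of z] by (simp add: fy neg_divide_le_eq)
    qed
  qed
  then show "\<exists>\<mu>\<ge>0. \<mu> *\<^sub>R (x - y) \<in> subdifferential f y"
    using \<open>\<mu> \<ge> 0\<close> d_def by blast
qed

text \<open>
  For a subgradient at \<open>y\<close> that is a nonnegative multiple of \<open>x - y\<close>, the Cauchy-Schwarz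
  inequality is an equality, so \<open>f\<close> grows from \<open>y\<close> to \<open>x\<close> at least at the rate of its norm.
\<close>
lemma residual_ge_infdist:
  fixes f :: "real^'n \<Rightarrow> real"
  assumes cv: "convex_on UNIV f" and ne: "sublevel f c \<noteq> {}" and x: "x \<notin> sublevel f c"
  defines "y \<equiv> closest_point (sublevel f c) x"
  shows "infdist 0 (subdifferential f y) * infdist x (sublevel f c) \<le> f x - c"
proof -
  obtain \<mu> where \<mu>: "\<mu> \<ge> 0" "\<mu> *\<^sub>R (x - y) \<in> subdifferential f y"
    using subgradient_normal_at_closest_point(1)[OF cv ne x] unfolding y_def by blast
  have fy: "f y = c"
    using subgradient_normal_at_closest_point(2)[OF cv ne x] unfolding y_def .
  have "infdist 0 (subdifferential f y) \<le> norm (\<mu> *\<^sub>R (x - y))"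
    using infdist_le[OF \<mu>(2), of 0] by simp
  then have "infdist 0 (subdifferential f y) * norm (x - y) \<le> \<mu> * norm (x - y) * norm (x - y)"
    using \<mu>(1) by (intro mult_right_mono) auto
  also have "\<dots> = (\<mu> *\<^sub>R (x - y)) \<bullet> (x - y)"
    by (simp add: dot_square_norm power2_eq_square)
  also have "\<dots> \<le> f x - f y"
    using \<mu>(2) unfolding subdifferential_def by (simp add: algebra_simps)
  finally show ?thesis
    using infdist_eq_dist_closest_point[OF sublevel_convex_closed(2)[OF cv] ne, of x]
    by (simp add: y_def[symmetric] dist_norm fy)
qed

section \<open>Uniqueness of the distances at minimisers\<close>

text \<open>
  Writing \<open>a powr p\<close> as the power \<open>p / 2 \<ge> 1\<close> of \<open>a\<^sup>2\<close> separates strictness from convexity: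
  squaring is strictly midpoint convex, and the outer power is increasing and convex. The
  case of a vanishing argument is split off since convexity of the outer power is used on
  the positive reals.
\<close>
lemma powr_midpoint_less:
  fixes a b p :: real
  assumes p: "p \<ge> 2" and "a \<ge> 0" "b \<ge> 0" "a \<noteq> b"
  shows "((a + b) / 2) powr p < (a powr p + b powr p) / 2"
proof -
  have pw: "t powr p = (t\<^sup>2) powr (p / 2)" if "t \<ge> 0" for t :: real
    using that by (cases "t = 0") (simp_all add: powr_powr flip: powr_numeral)
  have "0 < (a - b)\<^sup>2" using assms by simp
  then have "((a + b) / 2)\<^sup>2 < (a\<^sup>2 + b\<^sup>2) / 2"
    by (simp add: power2_eq_square field_simps)
  then have "((a + b) / 2) powr p < ((a\<^sup>2 + b\<^sup>2) / 2) powr (p / 2)"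
    using p assms by (simp add: pw powr_less_mono2)
  also have "\<dots> \<le> ((a\<^sup>2) powr (p / 2) + (b\<^sup>2) powr (p / 2)) / 2"
  proof -
    have half: "(t / 2) powr (p / 2) \<le> t powr (p / 2) / 2" if "t \<ge> 0" for t :: real
    proof -
      have "(2::real) powr 1 \<le> 2 powr (p / 2)" using p by (intro powr_mono) auto
      then have "t powr (p / 2) / 2 powr (p / 2) \<le> t powr (p / 2) / 2"
        by (intro divide_left_mono) auto
      then show ?thesis using that by (simp add: powr_divide)
    qed
    show ?thesis
    proof (cases "a = 0 \<or> b = 0")
      case True
      then show ?thesis using half[of "a\<^sup>2"] half[of "b\<^sup>2"] p by auto
    next
      case False
      have "convex_on {0<..} (\<lambda>t::real. t powr (p / 2))" using p by (intro powr_convex) auto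
      from convex_onD[OF this, of "1/2" "a\<^sup>2" "b\<^sup>2"] False show ?thesis
        by (simp add: field_simps)
    qed
  qed
  finally show ?thesis using assms by (simp add: pw)
qed

lemma infdist_midpoint_le:
  fixes S :: "'a::{real_inner, heine_borel} set"
  assumes "convex S" "closed S" "S \<noteq> {}"
  shows "infdist (midpoint x y) S \<le> (infdist x S + infdist y S) / 2"
proof -
  let ?a = "closest_point S x" and ?b = "closest_point S y"
  have "?a \<in> S" "?b \<in> S" using assms by (simp_all add: closest_point_in_set)
  then have "midpoint ?a ?b \<in> S"
    using convexD[OF assms(1), of ?a ?b "1/2" "1/2"]
    by (simp add: midpoint_def scaleR_right_distrib)
  then have "infdist (midpoint x y) S \<le> dist (midpoint x y) (midpoint ?a ?b)"
    by (rule infdist_le)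
  also have "\<dots> = norm ((x - ?a) + (y - ?b)) / 2"
  proof -
    have "midpoint x y - midpoint ?a ?b = (1/2) *\<^sub>R ((x - ?a) + (y - ?b))"
      by (simp add: midpoint_def algebra_simps)
    then show ?thesis by (simp add: dist_norm)
  qed
  also have "\<dots> \<le> (dist x ?a + dist y ?b) / 2"
    using norm_triangle_ineq[of "x - ?a" "y - ?b"] by (simp add: dist_norm)
  finally show ?thesis
    by (simp add: infdist_eq_dist_closest_point[OF assms(2,3)])
qed

lemma infdist_eq_of_minimizers:
  fixes S :: "'m::finite \<Rightarrow> (real^'n) set"
  assumes p: "p \<ge> 2" and S: "\<And>i. convex (S i)" "\<And>i. closed (S i)" "\<And>i. S i \<noteq> {}"
    and "convex C" and x: "x \<in> C" and y: "y \<in> C"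
    and minx: "\<And>z. z \<in> C \<Longrightarrow> wdist_sum p w S x \<le> wdist_sum p w S z"
    and miny: "\<And>z. z \<in> C \<Longrightarrow> wdist_sum p w S y \<le> wdist_sum p w S z"
    and w: "w $ i > 0"
  shows "infdist x (S i) = infdist y (S i)"
proof (rule ccontr)
  assume neq: "infdist x (S i) \<noteq> infdist y (S i)"
  let ?t = "\<lambda>x j. (w $ j) powr p * infdist x (S j) powr p"
  let ?z = "midpoint x y"
  have zC: "?z \<in> C"
    using convexD[OF \<open>convex C\<close> x y, of "1/2" "1/2"]
    by (simp add: midpoint_def scaleR_right_distrib)
  have step: "infdist ?z (S j) powr p \<le> ((infdist x (S j) + infdist y (S j)) / 2) powr p" for j
    using infdist_midpoint_le[OF S(1) S(2) S(3), of x y j] p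
    by (intro powr_mono2) (auto simp: infdist_nonneg)
  have strict: "((infdist x (S j) + infdist y (S j)) / 2) powr p
      < (infdist x (S j) powr p + infdist y (S j) powr p) / 2"
    if "infdist x (S j) \<noteq> infdist y (S j)" for j
    using powr_midpoint_less[OF p _ _ that] by (simp add: infdist_nonneg)
  have mid: "infdist ?z (S j) powr p \<le> (infdist x (S j) powr p + infdist y (S j) powr p) / 2" for j
    using step[of j] strict[of j] by (cases "infdist x (S j) = infdist y (S j)") auto
  have "(\<Sum>j\<in>UNIV. ?t ?z j) < (\<Sum>j\<in>UNIV. (?t x j + ?t y j) / 2)"
  proof (rule sum_strict_mono_ex1)
    show "\<forall>j\<in>UNIV. ?t ?z j \<le> (?t x j + ?t y j) / 2"
      using mult_left_mono[OF mid, of "(w $ j) powr p" j for j] by (simp add: algebra_simps)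
    have "infdist ?z (S i) powr p < (infdist x (S i) powr p + infdist y (S i) powr p) / 2"
      using step[of i] strict[OF neq] by linarith
    then have "?t ?z i < (?t x i + ?t y i) / 2"
      using mult_strict_left_mono[of _ _ "(w $ i) powr p"] w by (fastforce simp: algebra_simps)
    then show "\<exists>j\<in>UNIV. ?t ?z j < (?t x j + ?t y j) / 2" by blast
  qed simp
  also have "\<dots> = (wdist_sum p w S x + wdist_sum p w S y) / 2"
    by (simp add: wdist_sum_def sum.distrib flip: sum_divide_distrib)
  finally have "wdist_sum p w S ?z < (wdist_sum p w S x + wdist_sum p w S y) / 2"
    by (simp add: wdist_sum_def)
  moreover have "(wdist_sum p w S x + wdist_sum p w S y) / 2 \<le> wdist_sum p w S ?z"
    using add_mono[OF minx[OF zC] miny[OF zC]] by simp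
  ultimately show False by simp
qed

section \<open>Distances in the right-hand side space\<close>

lemma pnorm_mono:
  assumes "p > 0" "\<And>i. \<bar>a $ i\<bar> \<le> \<bar>b $ i\<bar>"
  shows "pnorm p a \<le> pnorm p b"
  unfolding pnorm_def using assms
  by (intro powr_mono2 sum_mono sum_nonneg) auto

lemma pnorm_weighted_infdist:
  assumes "\<And>i. w $ i \<ge> 0" "\<And>i. d $ i = w $ i * infdist x (S i)"
  shows "pnorm p d = (wdist_sum p w S x) powr (1 / p)"
proof -
  have "\<bar>d $ i\<bar> powr p = (w $ i) powr p * infdist x (S i) powr p" for i
    using assms by (simp add: powr_mult infdist_nonneg abs_mult)
  then show ?thesis by (simp add: pnorm_def wdist_sum_def)
qed

lemma pdist_le: "b' \<in> T \<Longrightarrow> pdist p b T \<le> pnorm p (b - b')"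
  unfolding pdist_def
  by (rule cINF_lower[OF bdd_belowI2[where m = 0]]) (auto simp: pnorm_def)

text \<open>The cheapest repair that makes \<open>x\<close> feasible raises exactly the violated bounds.\<close>
lemma pdist_consistent_rhs_le:
  fixes g :: "'m::finite \<Rightarrow> real^'n \<Rightarrow> real"
  assumes "p > 0" "\<And>i. g i x - b $ i \<le> d $ i" "\<And>i. 0 \<le> d $ i"
  shows "pdist p b (consistent_rhs g) \<le> pnorm p d"
proof -
  define b' where "b' = (\<chi> i. max (g i x) (b $ i))"
  have "\<forall>i. g i x \<le> b' $ i" by (simp add: b'_def)
  then have "b' \<in> consistent_rhs g" unfolding consistent_rhs_def by blast
  then have "pdist p b (consistent_rhs g) \<le> pnorm p (b - b')" by (rule pdist_le)
  also have "\<dots> \<le> pnorm p d"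
    using assms by (intro pnorm_mono) (auto simp: b'_def max_def abs_le_iff)
  finally show ?thesis .
qed

lemma pdist_consistent_rhs_ge:
  fixes g :: "'m::finite \<Rightarrow> real^'n \<Rightarrow> real"
  assumes "\<And>x b'. (\<And>i. g i x \<le> b' $ i) \<Longrightarrow> r \<le> pnorm p (b - b')"
  shows "r \<le> pdist p b (consistent_rhs g)"
proof -
  have "(\<chi> i. g i 0) \<in> consistent_rhs g" by (auto simp: consistent_rhs_def)
  then have "consistent_rhs g \<noteq> {}" by blast
  then show ?thesis
    unfolding pdist_def
    by (rule cINF_greatest) (auto simp: consistent_rhs_def intro: assms)
qed

section \<open>Minimisers of the weighted distance sums\<close>

lemma argmin_set_ind_funD:
  fixes f :: "'a \<Rightarrow> real"
  assumes "C \<noteq> {}" and x: "x \<in> argmin_set (\<lambda>x. ereal (f x) + ind_fun C x)"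
  shows "x \<in> C" and "z \<in> C \<Longrightarrow> f x \<le> f z"
proof -
  have min: "ereal (f x) + ind_fun C x \<le> ereal (f z) + ind_fun C z" for z
    using x by (auto simp: argmin_set_def is_arg_min_def not_less)
  obtain c where "c \<in> C" using assms(1) by blast
  then show xC: "x \<in> C" using min[of c] by (auto simp: ind_fun_def split: if_splits)
  show "f x \<le> f z" if "z \<in> C" using min[of z] that xC by (simp add: ind_fun_def)
qed

lemma argmin_setD: "x \<in> argmin_set f \<Longrightarrow> f x \<le> f z"
  by (auto simp: argmin_set_def is_arg_min_def not_less)

theorem corollary27:
  fixes g :: "'m::finite \<Rightarrow> real^'n \<Rightarrow> real"
    and bbar u l :: "real^'m"
    and p :: real
    and S :: "'m \<Rightarrow> (real^'n) set"
    and C ACu Al :: "(real^'n) set"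
  assumes "p \<ge> 2"
    and "\<And>i. convex_on UNIV (g i)"
    and "bbar \<notin> consistent_rhs g"
    and S_def: "\<And>i. S i = sublevel (g i) (bbar $ i)"
    and "\<And>i. S i \<noteq> {}"
    and "C \<noteq> {}" and "closed C" and "convex C"
    and "\<And>i x. x \<in> C \<Longrightarrow> u $ i \<ge> infdist 0 (subdifferential (g i) x)"
    and "\<And>i. 0 < l $ i"
    and "\<And>i x. x \<notin> S i \<Longrightarrow>
           l $ i \<le> infdist 0 (subdifferential (g i) (closest_point (S i) x))"
    and ACu_def: "ACu = argmin_set (\<lambda>x. ereal (wdist_sum p u S x) + ind_fun C x)"
    and Al_def: "Al = argmin_set (wdist_sum p l S)"
    and "ACu \<noteq> {}" and "Al \<noteq> {}"
  shows "(\<forall>i. (\<lambda>x. infdist x (S i)) constant_on ACu \<and> (\<lambda>x. infdist x (S i)) constant_on Al)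
    \<and> (\<forall>dplus. (\<forall>i. \<forall>x\<in>ACu. dplus $ i = u $ i * infdist x (S i)) \<longrightarrow>
          pdist p bbar (consistent_rhs g) \<le> pnorm p dplus)
    \<and> ((\<forall>i. \<exists>xhat. g i xhat < bbar $ i) \<longrightarrow>
        (\<forall>dminus. (\<forall>i. \<forall>x\<in>Al. dminus $ i = l $ i * infdist x (S i)) \<longrightarrow>
          pdist p bbar (consistent_rhs g) \<ge> pnorm p dminus))"
proof -
  note p = assms(1) and cv = assms(2) and Sne = assms(5)
    and C = assms(6,8) and u = assms(9) and l0 = assms(10) and l = assms(11)
  have S: "convex (S i)" "closed (S i)" for i
    using cv by (simp_all add: S_def sublevel_convex_closed)
  have ne: "sublevel (g i) (bbar $ i) \<noteq> {}" for i using Sne S_def by metis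
  have u0: "u $ i \<ge> 0" for i
  proof -
    obtain x where "x \<in> C" using C by blast
    then show ?thesis using u[of x i] infdist_nonneg order_trans by blast
  qed
  have upper: "g i x - bbar $ i \<le> u $ i * infdist x (S i)" if "x \<in> C" for i x
  proof -
    have "g i x - bbar $ i \<le> infdist 0 (subdifferential (g i) x) * infdist x (S i)"
      unfolding S_def by (rule residual_le_infdist[OF cv ne])
    also have "\<dots> \<le> u $ i * infdist x (S i)"
      using u[OF that] by (intro mult_right_mono) (auto simp: infdist_nonneg)
    finally show ?thesis .
  qed
  have lower: "l $ i * infdist x (S i) \<le> max 0 (g i x - bbar $ i)" for i x
  proof (cases "x \<in> S i")
    case False
    have "l $ i * infdist x (S i)
        \<le> infdist 0 (subdifferential (g i) (closest_point (S i) x)) * infdist x (S i)"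
      using l[OF False] by (intro mult_right_mono) (auto simp: infdist_nonneg)
    also have "\<dots> \<le> g i x - bbar $ i"
      using residual_ge_infdist[OF cv ne] False unfolding S_def by blast
    finally show ?thesis by simp
  qed simp
  have u_const: "infdist x (S i) = infdist y (S i)" if xy: "x \<in> ACu" "y \<in> ACu" for x y i
  proof -
    note minx = argmin_set_ind_funD[OF C(1) xy(1)[unfolded ACu_def]]
    note miny = argmin_set_ind_funD[OF C(1) xy(2)[unfolded ACu_def]]
    show ?thesis
    proof (cases "u $ i = 0")
      case True
      \<comment> \<open>A vanishing weight forces the residual to be nonpositive on all of \<open>C\<close>.\<close>
      then have "z \<in> S i" if "z \<in> C" for z
        using upper[OF that, of i] by (simp add: S_def sublevel_def)
      then show ?thesis using minx(1) miny(1) by simp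
    next
      case False
      then show ?thesis
        using infdist_eq_of_minimizers[OF p S Sne C(2) minx(1) miny(1) minx(2) miny(2)] u0[of i]
        by simp
    qed
  qed
  have l_const: "infdist x (S i) = infdist y (S i)" if xy: "x \<in> Al" "y \<in> Al" for x y i
    using infdist_eq_of_minimizers[OF p S Sne convex_UNIV UNIV_I UNIV_I
        argmin_setD[OF xy(1)[unfolded Al_def]] argmin_setD[OF xy(2)[unfolded Al_def]] l0]
    by blast
  have "pdist p bbar (consistent_rhs g) \<le> pnorm p dplus"
    if "\<forall>i. \<forall>x\<in>ACu. dplus $ i = u $ i * infdist x (S i)" for dplus
  proof -
    obtain x where x: "x \<in> ACu" using \<open>ACu \<noteq> {}\<close> by blast
    then have "x \<in> C" using argmin_set_ind_funD(1)[OF C(1)] ACu_def by blast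
    show ?thesis
      using p upper[OF \<open>x \<in> C\<close>] that x u0
      by (intro pdist_consistent_rhs_le[where x = x]) (auto simp: infdist_nonneg)
  qed
  moreover have "pnorm p dminus \<le> pdist p bbar (consistent_rhs g)"
    if d: "\<forall>i. \<forall>x\<in>Al. dminus $ i = l $ i * infdist x (S i)" for dminus
  proof (rule pdist_consistent_rhs_ge)
    fix x b assume feas: "\<And>i. g i x \<le> b $ i"
    obtain a where a: "a \<in> Al" using \<open>Al \<noteq> {}\<close> by blast
    have l_nonneg: "0 \<le> l $ i" for i using l0[of i] by simp
    have "wdist_sum p l S a \<le> wdist_sum p l S x"
      using a unfolding Al_def by (rule argmin_setD)
    moreover have "0 \<le> wdist_sum p l S a" by (simp add: wdist_sum_def sum_nonneg)
    moreover have "pnorm p dminus = wdist_sum p l S a powr (1 / p)"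
      using d a l_nonneg by (intro pnorm_weighted_infdist) auto
    moreover have "pnorm p (\<chi> i. l $ i * infdist x (S i)) = wdist_sum p l S x powr (1 / p)"
      using l_nonneg by (intro pnorm_weighted_infdist) auto
    ultimately have "pnorm p dminus \<le> pnorm p (\<chi> i. l $ i * infdist x (S i))"
      using p by (simp add: powr_mono2)
    also have "\<dots> \<le> pnorm p (bbar - b)"
    proof (rule pnorm_mono)
      fix i
      have "max 0 (g i x - bbar $ i) \<le> \<bar>bbar $ i - b $ i\<bar>" using feas[of i] by auto
      then show "\<bar>(\<chi> i. l $ i * infdist x (S i)) $ i\<bar> \<le> \<bar>(bbar - b) $ i\<bar>"
        using lower[of i x] l_nonneg[of i] by (simp add: abs_mult infdist_nonneg)
    qed (use p in simp)
    finally show "pnorm p dminus \<le> pnorm p (bbar - b)" .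
  qed
  moreover have "(\<lambda>x. infdist x (S i)) constant_on ACu" for i
    unfolding constant_on_def using u_const by metis
  moreover have "(\<lambda>x. infdist x (S i)) constant_on Al" for i
    unfolding constant_on_def using l_const by metis
  ultimately show ?thesis by simp
qed

end
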